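(* For all $v\in[0,1]$ and all $\varepsilon\in\mathbb S^{2\times2}$ with Frobenius norm $\sqrt2/2$, setting $t=|\mathrm{Tr}(\varepsilon)|$, the Hashin--Shtrikman correction term satisfies $q(t;v)\ge0$. Moreover, $q(t;v)=0$ if and only if $v\in\{0,1\}$ or $\Delta\kappa\,t=\Delta\mu\sqrt{1-t^2}$.
   Context: $\mathbb S^{2\times2}$ is the space of real symmetric $2\times2$ matrices. Real constants $0<\kappa^-<\kappa^+$, $0<\mu^-<\mu^+$ (bulk and shear moduli of two well-ordered isotropic phases) are given; $\Delta\kappa=\kappa^+-\kappa^-$, $\Delta\mu=\mu^+-\mu^-$. If $\|\varepsilon\|_F=\sqrt2/2$ then $t=|\mathrm{Tr}(\varepsilon)|\in[0,1]$. For $t,v\in[0,1]$ the correction term $q(t;v)$ is defined by $q(t;v)=\dfrac{v(1-v)(\Delta\kappa\,t-\Delta\mu\sqrt{1-t^2})^2}{\kappa^++\mu^+-(\Delta\kappa+\Delta\mu)v}$ if $v t\Delta\kappa\le(\kappa^++\mu^+-\Delta\kappa v)\sqrt{1-t^2}$ and $v\Delta\mu\sqrt{1-t^2}\le(\kappa^++\mu^+-\Delta\mu v)t$; $q(t;v)=(1-v)\Big[\dfrac{v t^2\Delta\kappa^2}{\kappa^++\mu^+-\Delta\kappa v}-(1-t^2)\Delta\mu\Big]$ if $v t\Delta\kappa>(\kappa^++\mu^+-\Delta\kappa v)\sqrt{1-t^2}$; $q(t;v)=(1-v)\Big[\dfrac{v\Delta\mu^2(1-t^2)}{\kappa^++\mu^+-\Delta\mu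 v}-t^2\Delta\kappa\Big]$ if $v\Delta\mu\sqrt{1-t^2}>(\kappa^++\mu^+-\Delta\mu v)t$. (The last two conditions are never satisfied simultaneously.) *)

theory Defs
  imports "HOL-Analysis.Analysis"
begin

text \<open>
  The norm of the library type \<open>real^'n^'m\<close> is the Euclidean norm of the vector of all entries,
  i.e. the Frobenius norm; it is not an operator norm.
\<close>

lemma norm_matrix_eq_frobenius:
  fixes A :: "real^'n^'m"
  shows "norm A = sqrt (\<Sum>i\<in>UNIV. \<Sum>j\<in>UNIV. (A $ i $ j)\<^sup>2)"
  by (simp add: norm_vec_def L2_set_def sum_nonneg)

text \<open>
  \<open>\<kappa>m < \<kappa>p\<close> are the bulk moduli and \<open>\<mu>m < \<mu>p\<close> the shear moduli of the two phases
  (\<open>m\<close> and \<open>p\<close> stand for the superscripts minus and plus). The final \<open>else\<close> branch is the regime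
  \<open>v * \<Delta>\<mu> * s > (K - \<Delta>\<mu> * v) * t\<close> with \<open>K = \<kappa>p + \<mu>p\<close> and \<open>s = sqrt (1 - t\<^sup>2)\<close>,
  as the first two conditions both fail there.
\<close>

definition hs_correction :: "real \<Rightarrow> real \<Rightarrow> real \<Rightarrow> real \<Rightarrow> real \<Rightarrow> real \<Rightarrow> real" where
  "hs_correction \<kappa>m \<kappa>p \<mu>m \<mu>p t v =
    (let \<Delta>\<kappa> = \<kappa>p - \<kappa>m; \<Delta>\<mu> = \<mu>p - \<mu>m in
      if v * t * \<Delta>\<kappa> \<le> (\<kappa>p + \<mu>p - \<Delta>\<kappa> * v) * sqrt (1 - t\<^sup>2)
         \<and> v * \<Delta>\<mu> * sqrt (1 - t\<^sup>2) \<le> (\<kappa>p + \<mu>p - \<Delta>\<mu> * v) * t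
      then v * (1 - v) * (\<Delta>\<kappa> * t - \<Delta>\<mu> * sqrt (1 - t\<^sup>2))\<^sup>2
             / (\<kappa>p + \<mu>p - (\<Delta>\<kappa> + \<Delta>\<mu>) * v)
      else if v * t * \<Delta>\<kappa> > (\<kappa>p + \<mu>p - \<Delta>\<kappa> * v) * sqrt (1 - t\<^sup>2)
      then (1 - v) * (v * t\<^sup>2 * \<Delta>\<kappa>\<^sup>2 / (\<kappa>p + \<mu>p - \<Delta>\<kappa> * v) - (1 - t\<^sup>2) * \<Delta>\<mu>)
      else (1 - v) * (v * \<Delta>\<mu>\<^sup>2 * (1 - t\<^sup>2) / (\<kappa>p + \<mu>p - \<Delta>\<mu> * v) - t\<^sup>2 * \<Delta>\<kappa>))"

end

theory Submission
  imports Defs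
begin

text \<open>
  Write \<open>a = \<Delta>\<kappa>\<close>, \<open>b = \<Delta>\<mu>\<close>, \<open>K = \<kappa>p + \<mu>p > a + b\<close> and \<open>s = sqrt (1 - t\<^sup>2)\<close>. The first regime is a
  square over a positive denominator. In the second, \<open>D = K - a * v\<close> satisfies \<open>b * v < D\<close>, so the
  regime condition \<open>s < v * t * a / D\<close> gives \<open>b * s\<^sup>2 < v * t\<^sup>2 * a\<^sup>2 / D\<close> and \<open>b * s < a * t\<close>:
  the correction vanishes only at \<open>v = 1\<close>, and \<open>a * t = b * s\<close> is impossible. The third regime
  is the second with \<open>(a, t)\<close> and \<open>(b, s)\<close> exchanged.
\<close>

text \<open>Cauchy-Schwarz on the diagonal entries, after which the squares of the off-diagonal
  entries are added.\<close>

lemma trace_square_le_card_norm_square: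
  fixes A :: "real^'n^'n"
  shows "(trace A)\<^sup>2 \<le> real CARD('n) * (norm A)\<^sup>2"
proof -
  have "(trace A)\<^sup>2 \<le> (\<Sum>i\<in>UNIV. (A $ i $ i)\<^sup>2) * real CARD('n)"
    unfolding trace_def by (rule sum_squared_le_sum_of_squares)
  also have "(\<Sum>i\<in>UNIV. (A $ i $ i)\<^sup>2) \<le> (\<Sum>i\<in>UNIV. \<Sum>j\<in>UNIV. (A $ i $ j)\<^sup>2)"
    by (intro sum_mono member_le_sum) auto
  also have "\<dots> = (norm A)\<^sup>2"
    by (simp add: norm_matrix_eq_frobenius sum_nonneg)
  finally show ?thesis by (simp add: mult.commute mult_right_mono)
qed

text \<open>The variables \<open>s\<close> and \<open>t\<close> are left unrelated, so the lemma can
  be reused with \<open>(a, t)\<close> and \<open>(b, s)\<close> exchanged.\<close>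

lemma saturated_regime_strict:
  fixes a b K v s t :: real
  assumes "0 < a" "0 < b" "a + b < K" "0 \<le> v" "v \<le> 1" "0 \<le> s"
    and regime: "(K - a * v) * s < v * t * a"
  shows "0 < v * t\<^sup>2 * a\<^sup>2 / (K - a * v) - s\<^sup>2 * b" and "b * s < a * t"
proof -
  define D where "D = K - a * v"
  have "a * v + b * v \<le> a + b"
    using assms mult_left_mono[of v 1 "a + b"] by (simp add: algebra_simps)
  then have bv: "b * v < D" using assms(3) unfolding D_def by linarith
  moreover have "0 \<le> b * v" using assms by simp
  ultimately have D: "0 < D" by linarith
  have Ds: "D * s < v * t * a" using regime by (simp add: D_def)
  \<comment> \<open>The regime inequality itself forces \<open>v\<close> and \<open>t\<close> to be
    positive, which the strict products below need.\<close>
  have "0 \<le> D * s" using D assms(6) by simp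
  with Ds have "0 < v * (t * a)" by (simp add: mult.assoc)
  then have v: "0 < v" and at: "0 < a * t"
    using assms(4) by (auto simp: zero_less_mult_iff mult.commute)
  have "D * (b * s) < (b * v) * (a * t)"
    using mult_strict_left_mono[OF Ds assms(2)] by (simp add: algebra_simps)
  also have "\<dots> < D * (a * t)" using bv at by (rule mult_strict_right_mono)
  finally show bs: "b * s < a * t" using D by simp
  have "D * (s\<^sup>2 * b) = (D * s) * (b * s)" by (simp add: power2_eq_square algebra_simps)
  also have "\<dots> \<le> (D * s) * (a * t)"
    using bs D assms(6) by (intro mult_left_mono) auto
  also have "\<dots> < (v * t * a) * (a * t)" using Ds at by (rule mult_strict_right_mono)
  also have "\<dots> = v * t\<^sup>2 * a\<^sup>2" by (simp add: power2_eq_square algebra_simps)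
  finally show "0 < v * t\<^sup>2 * a\<^sup>2 / (K - a * v) - s\<^sup>2 * b"
    using D by (simp add: D_def[symmetric] pos_less_divide_eq mult.commute)
qed

theorem proposition3p4:
  fixes \<kappa>m \<kappa>p \<mu>m \<mu>p v t :: real and \<epsilon> :: "real^2^2"
  assumes "0 < \<kappa>m" and "\<kappa>m < \<kappa>p"
    and "0 < \<mu>m" and "\<mu>m < \<mu>p"
    and "v \<in> {0..1}"
    and "transpose \<epsilon> = \<epsilon>"
    and "norm \<epsilon> = sqrt 2 / 2"
    and "t = \<bar>trace \<epsilon>\<bar>"
  shows "hs_correction \<kappa>m \<kappa>p \<mu>m \<mu>p t v \<ge> 0
    \<and> (hs_correction \<kappa>m \<kappa>p \<mu>m \<mu>p t v = 0 \<longleftrightarrow>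
        v \<in> {0, 1} \<or> (\<kappa>p - \<kappa>m) * t = (\<mu>p - \<mu>m) * sqrt (1 - t\<^sup>2))"
proof -
  define a b K s where defs: "a = \<kappa>p - \<kappa>m" "b = \<mu>p - \<mu>m" "K = \<kappa>p + \<mu>p" "s = sqrt (1 - t\<^sup>2)"
  have pos: "0 < a" "0 < b" and K: "a + b < K" using assms by (auto simp: defs)
  have v: "0 \<le> v" "v \<le> 1" and t: "0 \<le> t" using assms by auto
  \<comment> \<open>In dimension 2 the trace bound reads
    \<open>t\<^sup>2 \<le> 2 * (sqrt 2 / 2)\<^sup>2 = 1\<close>. Since \<open>sqrt\<close> is
    negative on negative reals, both facts about \<open>s\<close> rest on this.\<close>
  have "t\<^sup>2 \<le> 1"
    using trace_square_le_card_norm_square[of \<epsilon>] assms(7,8) by (simp add: power_divide)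
  then have s: "0 \<le> s" and s2: "s\<^sup>2 = 1 - t\<^sup>2" by (auto simp: defs)
  let ?q = "hs_correction \<kappa>m \<kappa>p \<mu>m \<mu>p t v"
  \<comment> \<open>Writing \<open>1 - t\<^sup>2\<close> as \<open>s\<^sup>2\<close> makes the
    symmetry between the last two regimes visible.\<close>
  have q: "?q =
    (if v * t * a \<le> (K - a * v) * s \<and> v * b * s \<le> (K - b * v) * t
     then v * (1 - v) * (a * t - b * s)\<^sup>2 / (K - (a + b) * v)
     else if v * t * a > (K - a * v) * s
     then (1 - v) * (v * t\<^sup>2 * a\<^sup>2 / (K - a * v) - s\<^sup>2 * b)
     else (1 - v) * (v * b\<^sup>2 * s\<^sup>2 / (K - b * v) - t\<^sup>2 * a))"
    unfolding s2 by (simp add: hs_correction_def Let_def defs)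
  consider (mid) "v * t * a \<le> (K - a * v) * s" "v * b * s \<le> (K - b * v) * t"
    | (bulk) "(K - a * v) * s < v * t * a"
    | (shear) "v * t * a \<le> (K - a * v) * s" "(K - b * v) * t < v * b * s"
    by linarith
  then have "?q \<ge> 0 \<and> (?q = 0 \<longleftrightarrow> v \<in> {0, 1} \<or> a * t = b * s)"
  proof cases
    case mid
    then have q1: "?q = v * (1 - v) * (a * t - b * s)\<^sup>2 / (K - (a + b) * v)"
      by (simp add: q)
    have "(a + b) * v \<le> a + b" using pos v mult_left_mono[of v 1 "a + b"] by simp
    then have "0 < K - (a + b) * v" using K by linarith
    then show ?thesis using v by (auto simp: q1)
  next
    case bulk
    note strict = saturated_regime_strict[OF pos K v s bulk]
    have q2: "?q = (1 - v) * (v * t\<^sup>2 * a\<^sup>2 / (K - a * v) - s\<^sup>2 * b)"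
      using bulk by (simp add: q)
    \<comment> \<open>At \<open>v = 0\<close> the regime would say \<open>K * s < 0\<close>.\<close>
    have "v \<noteq> 0" using bulk s pos K by (auto simp: mult_less_0_iff)
    then show ?thesis unfolding q2 using strict v by auto
  next
    case shear
    \<comment> \<open>The hypotheses are put in the exchanged form that the lemma expects, with
      \<open>t\<close> in the place of \<open>s\<close>.\<close>
    have K': "b + a < K" and r: "(K - b * v) * t < v * s * b"
      using K shear(2) by (simp_all add: algebra_simps)
    note strict = saturated_regime_strict[OF pos(2,1) K' v t r]
    have q3: "?q = (1 - v) * (v * s\<^sup>2 * b\<^sup>2 / (K - b * v) - t\<^sup>2 * a)"
      using shear by (simp add: q mult.assoc mult.commute[of "b\<^sup>2"])
    have "v \<noteq> 0" using r t pos K by (auto simp: mult_less_0_iff)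
    then show ?thesis unfolding q3 using strict v by auto
  qed
  then show ?thesis by (simp add: defs)
qed

end
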